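(* Let $\mathcal{H}$ be a nonzero real Hilbert space and let $\mathcal{K}$ be a finite-dimensional linear subspace of $\mathcal{H}$. Let $C$ and $D$ be nonempty convex subsets of $\mathcal{H}$ such that $C\neq\{0\}$ and $D\neq\{0\}$. Suppose that $C\subseteq\mathcal{K}$ or $D\subseteq\mathcal{K}$. Then there exists $(\bar{x},\bar{y})\in\mathcal{H}\times\mathcal{H}$ such that $(\bar{x},\bar{y})$ is a pair of principal vectors of $C$ and $D$.
   Context: $\mathbf{B}_{\mathcal{H}}=\{x\in\mathcal{H}:\|x\|\le 1\}$. A set $A\subseteq\mathcal{H}$ is a cone if $A=\mathbb{R}_{++}A$, where $\mathbb{R}_{++}=\{\lambda\in\mathbb{R}:\lambda>0\}$. $\overline{\operatorname{cone}}(A)$ is the smallest closed cone containing $A$; for $A$ convex it equals the closure of $\mathbb{R}_{++}A$. For nonempty convex sets $C,D\subseteq\mathcal{H}$, $(\bar{x},\bar{y})\in\mathcal{H}\times\mathcal{H}$ is a pair of principal vectors of $C$ and $D$ if $\bar{x}\in\overline{\operatorname{cone}}(C)\cap\mathbf{B}_{\mathcal{H}}$, $\bar{y}\in\overline{\operatorname{cone}}(D)\cap\mathbf{B}_{\mathcal{H}}$, and $$\langle\bar{x},\bar{y}\rangle=\sup\{\langle x,y\rangle : x\in\overline{\operatorname{cone}}(C)\cap\mathbf{B}_{\mathcal{H}},\ y\in\overline{\operatorname{cone}}(D)\cap\mathbf{B}_{\mathcal{H}}\}.$$ *)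

theory Defs
  imports "HOL-Analysis.Analysis"
begin

(* A = R_{++} A. Unlike the library's cone, the factor 0 is excluded, so a strict cone
   need not contain 0. *)
definition strict_cone :: "'a::real_vector set \<Rightarrow> bool" where
  "strict_cone A \<longleftrightarrow> A = {c *\<^sub>R x | c x. c > 0 \<and> x \<in> A}"

definition closed_cone_hull :: "'a::real_normed_vector set \<Rightarrow> 'a set" where
  "closed_cone_hull A = \<Inter> {K. strict_cone K \<and> closed K \<and> A \<subseteq> K}"

lemma strict_cone_iff: "strict_cone A \<longleftrightarrow> (\<forall>x\<in>A. \<forall>c>0. c *\<^sub>R x \<in> A)"
proof -
  have "A \<subseteq> {c *\<^sub>R x | c x. c > 0 \<and> x \<in> A}"
    using zero_less_one scaleR_one by (metis (mono_tags, lifting) mem_Collect_eq subsetI)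
  then show ?thesis
    unfolding strict_cone_def by blast
qed

lemma closed_cone_hull_is_smallest:
  "strict_cone (closed_cone_hull A)" "closed (closed_cone_hull A)" "A \<subseteq> closed_cone_hull A"
  "\<lbrakk>strict_cone K; closed K; A \<subseteq> K\<rbrakk> \<Longrightarrow> closed_cone_hull A \<subseteq> K"
  unfolding closed_cone_hull_def by (auto simp: strict_cone_iff intro!: closed_Inter)

(* Sup on the reals is the true supremum here: by Cauchy-Schwarz the set is bounded above by 1,
   and it is nonempty when C and D are, a nonempty closed cone containing 0. *)
definition principal_vectors :: "'a::real_inner set \<Rightarrow> 'a set \<Rightarrow> 'a \<times> 'a \<Rightarrow> bool" where
  "principal_vectors C D = (\<lambda>(x, y).
     x \<in> closed_cone_hull C \<inter> cball 0 1 \<and>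
     y \<in> closed_cone_hull D \<inter> cball 0 1 \<and>
     inner x y = Sup {inner u v | u v.
       u \<in> closed_cone_hull C \<inter> cball 0 1 \<and> v \<in> closed_cone_hull D \<inter> cball 0 1})"

(* The library's dim returns 0 on infinite-dimensional sets, hence the explicit finite basis. *)
definition finite_dim_subspace :: "'a::real_vector set \<Rightarrow> bool" where
  "finite_dim_subspace K \<longleftrightarrow>
     subspace K \<and> (\<exists>B. finite B \<and> independent B \<and> span B = K)"

end

theory Submission
  imports Defs
begin

text \<open>
  Say \<open>C \<subseteq> K\<close>. A maximizing sequence \<open>(x\<^sub>n, y\<^sub>n)\<close> has, by compactness in \<open>K\<close>, a subsequence with
  \<open>x\<^sub>n \<longlonglongrightarrow> x\<close>, so that \<open>\<langle>x, y\<^sub>n\<rangle>\<close> still tends to the supremum \<open>s\<close>. If \<open>s = 0\<close> take \<open>y = 0\<close>. If \<open>s > 0\<close>,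
  homogeneity gives \<open>\<langle>x, v\<rangle> \<le> s \<parallel>v\<parallel>\<close> on the convex cone generated by \<open>D\<close>; applied to \<open>v = y\<^sub>n + y\<^sub>m\<close>
  this forces \<open>\<parallel>y\<^sub>n + y\<^sub>m\<parallel>\<close> towards \<open>2\<close>, and the parallelogram law makes \<open>y\<^sub>n\<close> a Cauchy sequence. No weak
  compactness is needed.
\<close>

text \<open>The multiples of a member \<open>q\<close> by \<open>1 / (n + 1)\<close> stay in
  \<open>Q\<close> and shrink to 0, which closedness retains. This turns a nonempty closed strict
  cone into a \<open>cone\<close> in the library's sense.\<close>

lemma zero_in_closed_strict_cone:
  fixes Q :: "'a::real_normed_vector set"
  assumes "closed Q" "strict_cone Q" "Q \<noteq> {}"
  shows "0 \<in> Q"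
proof -
  obtain q where q: "q \<in> Q" using assms(3) by blast
  have "(\<lambda>n. inverse (real (Suc n)) *\<^sub>R q) \<longlonglongrightarrow> 0 *\<^sub>R q"
    by (intro tendsto_intros LIMSEQ_inverse_real_of_nat)
  moreover have "inverse (real (Suc n)) *\<^sub>R q \<in> Q" for n
    using assms(2) q by (simp add: strict_cone_iff)
  ultimately show ?thesis
    using assms(1) by (metis (no_types, lifting) closed_sequentially scaleR_zero_left)
qed

text \<open>Minimality on both sides gives equality; for \<open>A\<close> nonempty the two notions
  of cone agree on closed sets by way of 0. The formula makes the closed hull of a convex set
  visibly convex.\<close>

lemma closed_cone_hull_eq_closure_cone_hull: "closed_cone_hull A = closure (cone hull A)"
proof (cases "A = {}")
  case True
  have "closed_cone_hull A \<subseteq> {}"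
    using True by (intro closed_cone_hull_is_smallest(4)) (auto simp: strict_cone_iff)
  then show ?thesis using True by (simp add: cone_hull_expl)
next
  case False
  have "strict_cone (closure (cone hull A))"
    using cone_closure[OF cone_cone_hull, of A] by (auto simp: strict_cone_iff cone_def)
  moreover have "A \<subseteq> closure (cone hull A)"
    by (meson closure_subset hull_subset subset_trans)
  ultimately have le: "closed_cone_hull A \<subseteq> closure (cone hull A)"
    by (intro closed_cone_hull_is_smallest(4)) auto
  have "0 \<in> closed_cone_hull A"
    using closed_cone_hull_is_smallest(3)[of A] False
    by (intro zero_in_closed_strict_cone closed_cone_hull_is_smallest) auto
  then have "cone (closed_cone_hull A)"
    using closed_cone_hull_is_smallest(1)[of A]
    unfolding cone_def strict_cone_iff by (metis order_le_less scaleR_zero_left)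
  then have "cone hull A \<subseteq> closed_cone_hull A"
    by (intro hull_minimal closed_cone_hull_is_smallest(3))
  then have "closure (cone hull A) \<subseteq> closed_cone_hull A"
    by (intro closure_minimal closed_cone_hull_is_smallest(2))
  with le show ?thesis by blast
qed

text \<open>The ambient space may be infinite-dimensional, so both claims are read off coordinates
  in an orthogonal spanning set \<open>E\<close>: the span is the fixed-point set of a continuous
  projection, and its unit ball is a closed part of a compact box.\<close>

lemma finite_span_compact_ball:
  fixes B :: "'a::real_inner set"
  assumes "finite B"
  shows "closed (span B)" and "compact (span B \<inter> cball 0 1)"
proof -
  obtain E where E: "finite E" "span E = span B" "pairwise orthogonal E"
    using basis_orthogonal[OF assms] by blast
  let ?p = "\<lambda>x. \<Sum>e\<in>E. (inner x e / inner e e) *\<^sub>R e"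
  have exp: "?p x = x" if "x \<in> span E" for x
  proof -
    have p_in: "?p x \<in> span E" by (intro span_sum span_scale span_base)
    have "inner (x - ?p x) e = 0" if e: "e \<in> E" for e
    proof -
      have "inner (?p x) e = (\<Sum>d\<in>E. if d = e then inner x e else 0)"
        unfolding inner_sum_left
        by (intro sum.cong refl) (use E(3) e in \<open>auto simp: pairwise_def orthogonal_def\<close>)
      then show ?thesis using E(1) e by (simp add: inner_diff_left)
    qed
    \<comment> \<open>The residual is orthogonal to the whole span yet lies in it, so it is
      orthogonal to itself and vanishes.\<close>
    then have "orthogonal (x - ?p x) z" if "z \<in> span E" for z
      using that by (intro orthogonal_to_span[of z E]) (auto simp: orthogonal_def inner_commute)
    then have "orthogonal (x - ?p x) (x - ?p x)"
      using that p_in by (blast intro: span_diff)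
    then show ?thesis by (simp add: orthogonal_def)
  qed
  have "span E = {x. ?p x = x}"
  proof safe
    fix x assume "?p x = x"
    moreover have "?p x \<in> span E" by (intro span_sum span_scale span_base)
    ultimately show "x \<in> span E" by simp
  qed (rule exp)
  moreover have "closed {x. ?p x = x}"
    \<comment> \<open>As products with constants, the coefficients are continuous without any proof
      that \<open>inner e e\<close> is nonzero; \<open>E\<close> may contain 0.\<close>
    unfolding divide_inverse
    by (intro closed_Collect_eq continuous_on_sum continuous_on_scaleR continuous_on_mult
        continuous_on_inner continuous_on_id continuous_on_const)
  ultimately show cl: "closed (span B)" using E(2) by simp
  \<comment> \<open>The box of all combinations with coefficients bounded as on the unit ball. For
    \<open>e = 0\<close> the bound \<open>1 / norm e\<close> is 0. Each new vector adds a segment as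
    a Minkowski summand, which preserves compactness.\<close>
  define T where
    "T F = {\<Sum>e\<in>F. a e *\<^sub>R e | a. \<forall>e\<in>F. \<bar>a e\<bar> \<le> 1 / norm e}" for F :: "'a set"
  have "compact (T F)" if "finite F" for F
    using that
  proof induction
    case empty
    then show ?case by (simp add: T_def)
  next
    case (insert b F)
    let ?I = "(\<lambda>c. c *\<^sub>R b) ` {- 1 / norm b .. 1 / norm b}"
    let ?S = "{x + y | x y. x \<in> ?I \<and> y \<in> T F}"
    have "T (insert b F) \<subseteq> ?S"
    proof
      fix z assume "z \<in> T (insert b F)"
      then obtain a where a: "z = a b *\<^sub>R b + (\<Sum>e\<in>F. a e *\<^sub>R e)"
        "\<forall>e\<in>insert b F. \<bar>a e\<bar> \<le> 1 / norm e"
        using insert.hyps by (auto simp: T_def)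
      then show "z \<in> ?S"
        by (intro CollectI exI[of _ "a b *\<^sub>R b"] exI[of _ "\<Sum>e\<in>F. a e *\<^sub>R e"])
          (auto simp: T_def abs_le_iff)
    qed
    moreover have "?S \<subseteq> T (insert b F)"
    proof clarify
      fix c y assume c: "c \<in> {- 1 / norm b .. 1 / norm b}" and "y \<in> T F"
      then obtain a where a: "y = (\<Sum>e\<in>F. a e *\<^sub>R e)" "\<forall>e\<in>F. \<bar>a e\<bar> \<le> 1 / norm e"
        by (auto simp: T_def)
      have "(\<Sum>e\<in>insert b F. (a(b := c)) e *\<^sub>R e) = c *\<^sub>R b + y"
        using insert.hyps a(1) by (auto intro!: sum.cong)
      moreover have "\<forall>e\<in>insert b F. \<bar>(a(b := c)) e\<bar> \<le> 1 / norm e"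
        using a c by auto
      ultimately show "c *\<^sub>R b + y \<in> T (insert b F)"
        unfolding T_def by (intro CollectI exI[of _ "a(b := c)"]) simp
    qed
    ultimately have "T (insert b F) = ?S" by (rule subset_antisym)
    moreover have "compact ?I"
      by (intro compact_continuous_image continuous_intros compact_Icc)
    ultimately show ?case
      using compact_sums[OF _ insert.IH] by simp
  qed
  moreover have "span B \<inter> cball 0 1 \<subseteq> T E"
  proof
    fix x assume x: "x \<in> span B \<inter> cball 0 1"
    have "\<bar>inner x e / inner e e\<bar> \<le> 1 / norm e" for e
    proof (cases "e = 0")
      case False
      have "\<bar>inner x e\<bar> \<le> norm x * norm e" by (rule Cauchy_Schwarz_ineq2)
      also have "\<dots> \<le> norm e" using x by (simp add: mult_left_le_one_le)
      finally have "\<bar>inner x e\<bar> / (norm e * norm e) \<le> norm e / (norm e * norm e)"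
        by (intro divide_right_mono) auto
      then show ?thesis using False by (simp add: dot_square_norm power2_eq_square)
    qed simp
    moreover have "x = ?p x" using exp x E(2) by simp
    ultimately show "x \<in> T E"
      unfolding T_def by (intro CollectI exI[of _ "\<lambda>e. inner x e / inner e e"]) simp
  qed
  ultimately have "compact (T E \<inter> (span B \<inter> cball 0 1))"
    using E(1) cl by (intro compact_Int_closed) auto
  then show "compact (span B \<inter> cball 0 1)"
    using \<open>_ \<subseteq> T E\<close> by (simp add: Int_absorb1)
qed

text \<open>Compactness is available for \<open>P\<close> only. On the side of \<open>Q\<close>,
  scaling and convexity make a maximizing sequence Cauchy, and completeness supplies its
  limit.\<close>

lemma inner_attains_max_compact_cone:
  fixes P Q :: "'a::{real_inner,complete_space} set"
  assumes P: "compact P" "P \<noteq> {}"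
    and Q: "closed Q" "convex Q" "strict_cone Q" "Q \<noteq> {}"
  shows "\<exists>x\<in>P. \<exists>y\<in>Q \<inter> cball 0 1. \<forall>u\<in>P. \<forall>v\<in>Q \<inter> cball 0 1. inner u v \<le> inner x y"
proof -
  have scale: "c *\<^sub>R v \<in> Q" if "v \<in> Q" "c > 0" for c v
    using Q(3) that by (simp add: strict_cone_iff)
  have zero: "0 \<in> Q" using zero_in_closed_strict_cone Q by blast
  define S where "S = (\<lambda>(u, v). inner u v) ` (P \<times> (Q \<inter> cball 0 1))"
  define s where "s = Sup S"
  obtain R where R: "\<And>x. x \<in> P \<Longrightarrow> norm x \<le> R"
    using compact_imp_bounded[OF P(1)] by (auto simp: bounded_iff)
  have bdd: "bdd_above S"
  proof (rule bdd_aboveI[of _ R])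
    fix t assume "t \<in> S"
    then obtain u v where uv: "t = inner u v" "u \<in> P" "norm v \<le> 1" by (auto simp: S_def)
    have "inner u v \<le> norm u * norm v" by (rule norm_cauchy_schwarz)
    also have "\<dots> \<le> norm u" using uv by (simp add: mult_left_le)
    also have "\<dots> \<le> R" using R uv by blast
    finally show "t \<le> R" using uv by simp
  qed
  have s_ge: "inner u v \<le> s" if "u \<in> P" "v \<in> Q" "norm v \<le> 1" for u v
    unfolding s_def using that by (intro cSup_upper bdd) (auto simp: S_def)
  have ne: "S \<noteq> {}" using P(2) zero by (auto simp: S_def)
  obtain p where p: "p \<in> P" using P(2) by blast
  show ?thesis
  proof (cases "s > 0")
    \<comment> \<open>All values are at most \<open>s\<close>, hence at most 0, and the pair
      \<open>(p, 0)\<close> attains 0.\<close>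
    case False
    then have "inner u v \<le> inner p 0" if "u \<in> P" "v \<in> Q \<inter> cball 0 1" for u v
      using s_ge[of u v] that by simp
    then show ?thesis using p zero by (intro bexI[of _ p] bexI[of _ 0]) auto
  next
    case True
    have "\<exists>u v. u \<in> P \<and> v \<in> Q \<and> norm v \<le> 1 \<and> inner u v > s - inverse (real (Suc n))" for n
    proof -
      have "s - inverse (real (Suc n)) < Sup S" by (simp add: s_def)
      then obtain t where "t \<in> S" "s - inverse (real (Suc n)) < t"
        using less_cSup_iff[OF ne bdd] by blast
      moreover obtain u v where "t = inner u v" "u \<in> P" "v \<in> Q" "norm v \<le> 1"
        using \<open>t \<in> S\<close> by (auto simp: S_def)
      ultimately show ?thesis by blast
    qed
    then obtain X Y where XY: "\<And>n. X n \<in> P" "\<And>n. Y n \<in> Q" "\<And>n. norm (Y n) \<le> 1"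
      "\<And>n. inner (X n) (Y n) > s - inverse (real (Suc n))" by metis
    obtain x r where x: "x \<in> P" "strict_mono r" "(X \<circ> r) \<longlonglongrightarrow> x"
      using P(1) XY(1) unfolding compact_def by blast
    define y where "y = Y \<circ> r"
    have y: "y n \<in> Q" "norm (y n) \<le> 1" for n using XY by (auto simp: y_def)
    have "(\<lambda>n. s - inverse (real (Suc n))) \<longlonglongrightarrow> s - 0"
      by (intro tendsto_intros LIMSEQ_inverse_real_of_nat)
    then have "(\<lambda>n. s - inverse (real (Suc n))) \<longlonglongrightarrow> s" by simp
    then have "(\<lambda>n. inner (X n) (Y n)) \<longlonglongrightarrow> s"
    proof (rule tendsto_sandwich[OF always_eventually always_eventually _ tendsto_const, rotated 2])
      show "\<forall>n. s - inverse (real (Suc n)) \<le> inner (X n) (Y n)"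
        using XY(4) by (blast intro: less_imp_le)
      show "\<forall>n. inner (X n) (Y n) \<le> s" using s_ge XY(1-3) by blast
    qed
    from LIMSEQ_subseq_LIMSEQ[OF this x(2)]
    have lim1: "(\<lambda>n. inner (X (r n)) (y n)) \<longlonglongrightarrow> s"
      by (simp add: o_def y_def)
    \<comment> \<open>Replacing \<open>X (r n)\<close> by its limit \<open>x\<close> costs at most
      \<open>norm (X (r n) - x)\<close>, since the \<open>y n\<close> lie in the unit ball.\<close>
    have "(\<lambda>n. X (r n) - x) \<longlonglongrightarrow> 0" using x(3) by (simp add: o_def LIM_zero)
    then have "(\<lambda>n. norm (X (r n) - x)) \<longlonglongrightarrow> 0" by (rule tendsto_norm_zero)
    moreover have "\<forall>n. norm (inner (X (r n) - x) (y n)) \<le> norm (X (r n) - x)"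
    proof
      fix n
      have "\<bar>inner (X (r n) - x) (y n)\<bar> \<le> norm (X (r n) - x) * norm (y n)"
        by (rule Cauchy_Schwarz_ineq2)
      also have "\<dots> \<le> norm (X (r n) - x)" using y by (simp add: mult_left_le)
      finally show "norm (inner (X (r n) - x) (y n)) \<le> norm (X (r n) - x)" by simp
    qed
    ultimately have "(\<lambda>n. inner (X (r n) - x) (y n)) \<longlonglongrightarrow> 0"
      by (rule Lim_null_comparison[OF always_eventually, rotated])
    from tendsto_diff[OF lim1 this] have lim: "(\<lambda>n. inner x (y n)) \<longlonglongrightarrow> s"
      by (simp add: inner_diff_left)
    \<comment> \<open>Normalizing \<open>v\<close> extends the bound beyond the unit ball, where the
      sums \<open>y m + y n\<close> may lie.\<close>
    have hom: "inner x v \<le> s * norm v" if "v \<in> Q" for v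
    proof (cases "v = 0")
      case False
      then have "inner x ((1 / norm v) *\<^sub>R v) \<le> s"
        using that x by (intro s_ge scale) auto
      then show ?thesis using False by (simp add: field_simps)
    qed simp
    have "Cauchy y"
    proof (rule CauchyI)
      fix e :: real assume e: "e > 0"
      \<comment> \<open>The parallelogram law will give
        \<open>(norm (y m - y n))\<^sup>2 \<le> 4 - (4 - 8 * d) = 8 * d\<close>, strictly below
        \<open>16 * d \<le> e\<^sup>2\<close>. The cap \<open>1/2\<close> keeps
        \<open>2 * (1 - d)\<close> nonnegative for squaring.\<close>
      define d where "d = min (1/2) (e\<^sup>2 / 16)"
      have d: "0 < d" "d \<le> 1/2" "16 * d \<le> e\<^sup>2" using e by (auto simp: d_def min_def)
      have "eventually (\<lambda>n. inner x (y n) > s * (1 - d)) sequentially"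
        using True d by (intro order_tendstoD(1)[OF lim]) auto
      then obtain N where N: "\<And>n. n \<ge> N \<Longrightarrow> inner x (y n) > s * (1 - d)"
        by (auto simp: eventually_sequentially)
      have "norm (y m - y n) < e" if "m \<ge> N" "n \<ge> N" for m n
      proof -
        \<comment> \<open>Convexity yields the midpoint and the cone property doubles it.\<close>
        have "(1/2) *\<^sub>R y m + (1/2) *\<^sub>R y n \<in> Q"
          using Q(2) y unfolding convex_def by simp
        from scale[OF this, of 2] have "y m + y n \<in> Q" by (simp add: scaleR_add_right)
        then have "s * (2 * (1 - d)) \<le> s * norm (y m + y n)"
          using hom[of "y m + y n"] N[OF that(1)] N[OF that(2)]
          by (simp add: inner_add_right algebra_simps)
        then have "2 * (1 - d) \<le> norm (y m + y n)" using True by simp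
        then have "(2 * (1 - d))\<^sup>2 \<le> (norm (y m + y n))\<^sup>2"
          using d by (intro power_mono) auto
        moreover have "(norm (y m - y n))\<^sup>2 + (norm (y m + y n))\<^sup>2
            = 2 * (norm (y m))\<^sup>2 + 2 * (norm (y n))\<^sup>2"
          by (simp add: power2_norm_eq_inner inner_diff_left inner_diff_right
              inner_add_left inner_add_right inner_commute)
        moreover have "(norm (y m))\<^sup>2 \<le> 1" "(norm (y n))\<^sup>2 \<le> 1"
          using y by (auto simp: power_le_one)
        moreover have "(2 * (1 - d))\<^sup>2 \<ge> 4 - 8 * d" by (simp add: power2_eq_square algebra_simps)
        ultimately have "(norm (y m - y n))\<^sup>2 < e\<^sup>2" using d by linarith
        then show ?thesis using e by (simp add: power2_less_imp_less)
      qed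
      then show "\<exists>M. \<forall>m\<ge>M. \<forall>n\<ge>M. norm (y m - y n) < e" by blast
    qed
    then obtain z where z: "y \<longlonglongrightarrow> z" using Cauchy_convergent convergentD by blast
    have "z \<in> Q \<inter> cball 0 1"
    proof (rule closed_sequentially[OF _ _ z])
      show "closed (Q \<inter> cball 0 1)" using Q(1) by (rule closed_Int[OF _ closed_cball])
    qed (simp add: y)
    moreover have "inner x z = s"
      using LIMSEQ_unique[OF tendsto_inner[OF tendsto_const z] lim] .
    ultimately show ?thesis using x(1) s_ge by (intro bexI[of _ x] bexI[of _ z]) auto
  qed
qed

text \<open>Lets the case \<open>D \<subseteq> K\<close> be reduced to the case
  \<open>C \<subseteq> K\<close>.\<close>

lemma principal_vectors_sym: "principal_vectors C D (x, y) \<longleftrightarrow> principal_vectors D C (y, x)"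
proof -
  have swap: "{inner u v | u v. u \<in> A \<and> v \<in> B} = {inner u v | u v. u \<in> B \<and> v \<in> A}"
    for A B :: "'a set"
    by (auto simp: inner_commute) (metis inner_commute)+
  show ?thesis
    unfolding principal_vectors_def prod.case
      swap[of "closed_cone_hull C \<inter> cball 0 1" "closed_cone_hull D \<inter> cball 0 1"]
    by (simp only: inner_commute conj_ac)
qed

text \<open>The subspace \<open>K\<close> is itself a closed strict cone containing
  \<open>C\<close>, so it contains the closed hull of \<open>C\<close>, whose unit slice is
  therefore compact. The attainment lemma then applies with the closed hull of \<open>D\<close> as
  \<open>Q\<close>.\<close>

lemma principal_vectors_exist_if_left_finite_dim:
  fixes C D K :: "'a::{real_inner,complete_space} set"
  assumes K: "finite_dim_subspace K" "C \<subseteq> K"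
    and C: "C \<noteq> {}" and D: "D \<noteq> {}" "convex D"
  shows "\<exists>x y. principal_vectors C D (x, y)"
proof -
  note hull = closed_cone_hull_is_smallest
  obtain B where B: "finite B" "span B = K" "subspace K"
    using K by (auto simp: finite_dim_subspace_def)
  note fin = finite_span_compact_ball[OF B(1), unfolded B(2)]
  let ?P = "closed_cone_hull C \<inter> cball 0 1" and ?Q = "closed_cone_hull D \<inter> cball 0 1"
  have "strict_cone K" using B(3) by (simp add: strict_cone_iff subspace_scale)
  then have "closed_cone_hull C \<subseteq> K" using hull(4) fin(1) K(2) by blast
  then have "?P = K \<inter> cball 0 1 \<inter> closed_cone_hull C" by blast
  then have P: "compact ?P" using compact_Int_closed[OF fin(2) hull(2)] by simp
  have "0 \<in> ?P" using zero_in_closed_strict_cone[OF hull(2,1)] hull(3)[of C] C by auto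
  then have "?P \<noteq> {}" by blast
  moreover have "convex (closed_cone_hull D)"
    using D by (simp add: closed_cone_hull_eq_closure_cone_hull convex_closure convex_cone_hull)
  moreover have "closed_cone_hull D \<noteq> {}" using hull(3)[of D] D(1) by auto
  ultimately have "\<exists>x\<in>?P. \<exists>y\<in>?Q. \<forall>u\<in>?P. \<forall>v\<in>?Q. inner u v \<le> inner x y"
    by (intro inner_attains_max_compact_cone P hull(1,2))
  then obtain x y where xy: "x \<in> ?P" "y \<in> ?Q"
    "\<And>u v. u \<in> ?P \<Longrightarrow> v \<in> ?Q \<Longrightarrow> inner u v \<le> inner x y"
    by blast
  \<comment> \<open>An attained upper bound is the supremum, so no separate boundedness argument is
    called for.\<close>
  have "Sup {inner u v | u v. u \<in> ?P \<and> v \<in> ?Q} = inner x y"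
    by (rule cSup_eq_maximum) (use xy in blast)+
  then have "principal_vectors C D (x, y)"
    using xy(1,2) unfolding principal_vectors_def by simp
  then show ?thesis by blast
qed

theorem proposition3p3:
  fixes C D K :: "'a::{real_inner,complete_space} set"
  assumes "(UNIV :: 'a set) \<noteq> {0}"
    and "finite_dim_subspace K"
    and "C \<noteq> {}" and "convex C" and "C \<noteq> {0}"
    and "D \<noteq> {}" and "convex D" and "D \<noteq> {0}"
    and "C \<subseteq> K \<or> D \<subseteq> K"
  shows "\<exists>xy. principal_vectors C D xy"
  using assms(9)
proof
  assume "C \<subseteq> K"
  then show ?thesis
    using principal_vectors_exist_if_left_finite_dim[OF assms(2) _ assms(3,6,7)] by blast
next
  assume "D \<subseteq> K"
  then show ?thesis
    using principal_vectors_exist_if_left_finite_dim[OF assms(2) _ assms(6,3,4)]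
      principal_vectors_sym[of D C] by blast
qed

end
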